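(* For every integer $n\ge1$, writing $n=2^m(2k+1)$ with integers $m,k\ge0$ and $\beta_n:=2^m(k+1)$, we have $\Delta_\omega(n)=\Delta_2(n)=\beta_n\le\Delta_1(n)\le n$.
   Context: A metric space $X$ is $k$-homogeneous if every bijective isometry $f\colon A\to B$ between subspaces $A,B\subseteq X$ with $|A|\le k$ extends to a bijective isometry $X\to X$; it is ultrahomogeneous if it is $k$-homogeneous for every $k\ge1$. Let $\delta(X)$ be the number of distinct values $d(x,y)$, $x,y\in X$ (including the value $0$). For $k,n\ge1$, $\Delta_k(n)$ is the maximum of $\delta(X)$ over all $k$-homogeneous metric spaces $X$ with $|X|=n$, and $\Delta_\omega(n)$ is the maximum of $\delta(X)$ over all ultrahomogeneous metric spaces $X$ with $|X|=n$. *)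

theory Defs
  imports "HOL-Analysis.Analysis"
begin

definition bijective_isometry ::
    "('a \<Rightarrow> 'a \<Rightarrow> real) \<Rightarrow> 'a set \<Rightarrow> 'a set \<Rightarrow> ('a \<Rightarrow> 'a) \<Rightarrow> bool" where
  "bijective_isometry d A B f \<longleftrightarrow>
     bij_betw f A B \<and> (\<forall>x\<in>A. \<forall>y\<in>A. d (f x) (f y) = d x y)"

(* finite A is needed because card A = 0 for infinite A *)
definition k_homogeneous :: "nat \<Rightarrow> 'a set \<Rightarrow> ('a \<Rightarrow> 'a \<Rightarrow> real) \<Rightarrow> bool" where
  "k_homogeneous k X d \<longleftrightarrow>
     (\<forall>A B f. A \<subseteq> X \<and> B \<subseteq> X \<and> finite A \<and> card A \<le> k \<and> bijective_isometry d A B f \<longrightarrow>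
        (\<exists>g. bijective_isometry d X X g \<and> (\<forall>x\<in>A. g x = f x)))"

definition ultrahomogeneous :: "'a set \<Rightarrow> ('a \<Rightarrow> 'a \<Rightarrow> real) \<Rightarrow> bool" where
  "ultrahomogeneous X d \<longleftrightarrow> (\<forall>k\<ge>1. k_homogeneous k X d)"

definition num_distances :: "'a set \<Rightarrow> ('a \<Rightarrow> 'a \<Rightarrow> real) \<Rightarrow> nat" where
  "num_distances X d = card {d x y | x y. x \<in> X \<and> y \<in> X}"

(* The maxima are meant for n \<ge> 1. There card X = n forces X to be finite, so up to isometry
   every space in question has its points in nat; see num_distances_le_Delta and
   num_distances_le_Delta_ultra below for spaces over an arbitrary type. *)
definition Delta :: "nat \<Rightarrow> nat \<Rightarrow> nat" where
  "Delta k n = Max {num_distances X d | (X :: nat set) d.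
     Metric_space X d \<and> card X = n \<and> k_homogeneous k X d}"

definition Delta_ultra :: "nat \<Rightarrow> nat" where
  "Delta_ultra n = Max {num_distances X d | (X :: nat set) d.
     Metric_space X d \<and> card X = n \<and> ultrahomogeneous X d}"

lemma num_distances_le_square:
  assumes "finite X"
  shows "num_distances X d \<le> card X * card X"
proof -
  have eq: "{d x y | x y. x \<in> X \<and> y \<in> X} = (\<lambda>(x, y). d x y) ` (X \<times> X)"
    by auto
  show ?thesis
    unfolding num_distances_def eq
    using card_image_le[of "X \<times> X" "\<lambda>(x, y). d x y"] assms
    by (simp add: card_cartesian_product)
qed

lemma finite_num_distances:
  assumes "n \<ge> 1"
  shows "finite {num_distances X d | (X :: nat set) d. Metric_space X d \<and> card X = n \<and> P X d}"
proof (rule finite_subset)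
  show "{num_distances X d | (X :: nat set) d. Metric_space X d \<and> card X = n \<and> P X d} \<subseteq> {..n * n}"
  proof
    fix c assume "c \<in> {num_distances X d | (X :: nat set) d. Metric_space X d \<and> card X = n \<and> P X d}"
    then obtain X :: "nat set" and d where "c = num_distances X d" "card X = n"
      by blast
    moreover from this have "finite X"
      using assms by (metis card.infinite not_one_le_zero)
    ultimately show "c \<in> {..n * n}"
      using num_distances_le_square[of X d] by simp
  qed
qed simp

lemma ultrahomogeneous_discrete:
  fixes X :: "'a set"
  assumes "finite X"
  shows "ultrahomogeneous X (\<lambda>x y. if x = y then 0 else 1 :: real)"
  unfolding ultrahomogeneous_def k_homogeneous_def
proof (intro allI impI)
  fix k :: nat and A B :: "'a set" and f
  assume H: "A \<subseteq> X \<and> B \<subseteq> X \<and> finite A \<and> card A \<le> k \<and>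
    bijective_isometry (\<lambda>x y. if x = y then 0 else 1 :: real) A B f"
  then have f: "bij_betw f A B"
    by (simp add: bijective_isometry_def)
  have "card (X - A) = card (X - B)"
    using H bij_betw_same_card[OF f] finite_subset[OF _ assms]
    by (simp add: card_Diff_subset)
  then obtain h where h: "bij_betw h (X - A) (X - B)"
    using finite_same_card_bij[of "X - A" "X - B"] assms by auto
  define g where "g x = (if x \<in> A then f x else h x)" for x
  have "bij_betw g A B" "bij_betw g (X - A) (X - B)"
    using f h bij_betw_cong[of A g f B] bij_betw_cong[of "X - A" g h "X - B"]
    by (simp_all add: g_def)
  then have "bij_betw g (A \<union> (X - A)) (B \<union> (X - B))"
    by (rule bij_betw_combine) auto
  then have g: "bij_betw g X X"
    using H by (simp add: Un_absorb1)
  then have "bijective_isometry (\<lambda>x y. if x = y then 0 else 1 :: real) X X g"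
    by (auto simp: bijective_isometry_def bij_betw_def inj_on_def)
  then show "\<exists>g. bijective_isometry (\<lambda>x y. if x = y then 0 else 1 :: real) X X g \<and>
      (\<forall>x\<in>A. g x = f x)"
    by (auto simp: g_def)
qed

lemma ex_ultrahomogeneous:
  "\<exists>(X :: nat set) d. Metric_space X d \<and> card X = n \<and> ultrahomogeneous X d"
proof (intro exI conjI)
  show "Metric_space {..<n} (\<lambda>x y. if x = y then 0 else 1 :: real)"
    by unfold_locales auto
qed (simp_all add: ultrahomogeneous_discrete)

lemma Delta_attained:
  assumes "n \<ge> 1" "k \<ge> 1"
  shows "\<exists>(X :: nat set) d. Metric_space X d \<and> card X = n \<and> k_homogeneous k X d \<and>
           num_distances X d = Delta k n"
proof -
  have "{num_distances X d | (X :: nat set) d.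
     Metric_space X d \<and> card X = n \<and> k_homogeneous k X d} \<noteq> {}"
    using ex_ultrahomogeneous[of n] assms(2) by (auto simp: ultrahomogeneous_def)
  from Max_in[OF finite_num_distances[OF assms(1)] this]
  show ?thesis
    unfolding Delta_def by force
qed

lemma Delta_ultra_attained:
  assumes "n \<ge> 1"
  shows "\<exists>(X :: nat set) d. Metric_space X d \<and> card X = n \<and> ultrahomogeneous X d \<and>
           num_distances X d = Delta_ultra n"
proof -
  have "{num_distances X d | (X :: nat set) d.
     Metric_space X d \<and> card X = n \<and> ultrahomogeneous X d} \<noteq> {}"
    using ex_ultrahomogeneous[of n] by auto
  from Max_in[OF finite_num_distances[OF assms] this]
  show ?thesis
    unfolding Delta_ultra_def by force
qed

context
  fixes X :: "'a set" and d :: "'a \<Rightarrow> 'a \<Rightarrow> real" and h :: "'a \<Rightarrow> 'b" and Y i e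
  assumes h: "bij_betw h X Y"
  defines "i \<equiv> the_inv_into X h"
    and "e \<equiv> \<lambda>u v. d (i u) (i v)"
begin

lemma i_bij: "bij_betw i Y X"
  unfolding i_def using h by (rule bij_betw_the_inv_into)

lemma ih: "x \<in> X \<Longrightarrow> i (h x) = x"
  using h unfolding i_def by (simp add: bij_betw_def the_inv_into_f_f)

lemma hi: "u \<in> Y \<Longrightarrow> h (i u) = u"
  using h unfolding i_def by (metis bij_betw_def f_the_inv_into_f)

lemma h_in: "x \<in> X \<Longrightarrow> h x \<in> Y"
  using bij_betwE[OF h] by blast

lemma i_in: "u \<in> Y \<Longrightarrow> i u \<in> X"
  using bij_betwE[OF i_bij] by blast

lemma Metric_space_transport:
  assumes "Metric_space X d"
  shows "Metric_space Y e"
proof -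
  interpret Metric_space X d by fact
  show ?thesis
  proof
    fix u v assume "u \<in> Y" "v \<in> Y"
    then show "e u v = 0 \<longleftrightarrow> u = v"
      using hi i_in by (metis e_def zero)
  qed (simp_all add: e_def commute i_in triangle)
qed

lemma num_distances_transport: "num_distances Y e = num_distances X d"
proof -
  have "{e u v | u v. u \<in> Y \<and> v \<in> Y} = {d x y | x y. x \<in> X \<and> y \<in> X}"
  proof (intro set_eqI iffI)
    fix r assume "r \<in> {e u v | u v. u \<in> Y \<and> v \<in> Y}"
    then show "r \<in> {d x y | x y. x \<in> X \<and> y \<in> X}"
      using i_in by (auto simp: e_def)
  next
    fix r assume "r \<in> {d x y | x y. x \<in> X \<and> y \<in> X}"
    then obtain x y where "r = d x y" "x \<in> X" "y \<in> X"
      by blast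
    then have "r = e (h x) (h y)" "h x \<in> Y" "h y \<in> Y"
      by (simp_all add: e_def ih h_in)
    then show "r \<in> {e u v | u v. u \<in> Y \<and> v \<in> Y}"
      by blast
  qed
  then show ?thesis by (simp add: num_distances_def)
qed

lemma k_homogeneous_transport:
  assumes "k_homogeneous k X d"
  shows "k_homogeneous k Y e"
  unfolding k_homogeneous_def
proof (intro allI impI)
  fix A B f
  assume H: "A \<subseteq> Y \<and> B \<subseteq> Y \<and> finite A \<and> card A \<le> k \<and> bijective_isometry e A B f"
  define f' where "f' = i \<circ> (f \<circ> h)"
  have inj: "inj_on i A"
    using H i_bij by (meson bij_betw_def inj_on_subset)
  have 1: "bij_betw h (i ` A) A"
    using H hi by (intro bij_betw_byWitness[where f' = i]) (auto simp: subset_iff)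
  have 2: "bij_betw i B (i ` B)"
    using H i_bij by (meson bij_betw_subset)
  have 3: "bij_betw f A B" and fi: "\<And>u v. u \<in> A \<Longrightarrow> v \<in> A \<Longrightarrow> e (f u) (f v) = e u v"
    using H by (auto simp: bijective_isometry_def)
  have "bij_betw f' (i ` A) (i ` B)"
    unfolding f'_def by (intro bij_betw_trans[OF bij_betw_trans[OF 1 3] 2])
  moreover have "d (f' x) (f' y) = d x y" if "x \<in> i ` A" "y \<in> i ` A" for x y
    using that H fi by (auto simp: f'_def e_def hi subset_iff)
  ultimately have "bijective_isometry d (i ` A) (i ` B) f'"
    by (simp add: bijective_isometry_def)
  moreover have "i ` A \<subseteq> X" "i ` B \<subseteq> X" "finite (i ` A)" "card (i ` A) \<le> k"
    using H i_in inj by (auto simp: card_image)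
  ultimately obtain g where g: "bijective_isometry d X X g" "\<And>x. x \<in> i ` A \<Longrightarrow> g x = f' x"
    using assms unfolding k_homogeneous_def by metis
  define g' where "g' = h \<circ> (g \<circ> i)"
  have gb: "bij_betw g X X" and gi: "\<And>x y. x \<in> X \<Longrightarrow> y \<in> X \<Longrightarrow> d (g x) (g y) = d x y"
    using g(1) by (auto simp: bijective_isometry_def)
  have "bij_betw g' Y Y"
    unfolding g'_def by (intro bij_betw_trans[OF bij_betw_trans[OF i_bij gb] h])
  moreover have "e (g' u) (g' v) = e u v" if "u \<in> Y" "v \<in> Y" for u v
    using that gi i_in ih bij_betwE[OF gb] by (auto simp: g'_def e_def)
  moreover have "g' u = f u" if "u \<in> A" for u
  proof -
    have "u \<in> Y" "f u \<in> Y"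
      using that H 3 bij_betwE by blast+
    then show ?thesis
      using g(2)[of "i u"] that by (simp add: g'_def f'_def hi)
  qed
  ultimately show "\<exists>g. bijective_isometry e Y Y g \<and> (\<forall>x\<in>A. g x = f x)"
    by (auto simp: bijective_isometry_def)
qed

end

lemma num_distances_le_Delta:
  fixes X :: "'a set"
  assumes "Metric_space X d" "card X = n" "n \<ge> 1" "k_homogeneous k X d"
  shows "num_distances X d \<le> Delta k n"
proof -
  have "finite X"
    using assms(2,3) by (metis card.infinite not_one_le_zero)
  then obtain h where h: "bij_betw h X {0..<n}"
    using ex_bij_betw_finite_nat assms(2) by blast
  let ?e = "\<lambda>u v. d (the_inv_into X h u) (the_inv_into X h v)"
  show ?thesis
    unfolding Delta_def num_distances_transport[OF h, of d, symmetric]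
    by (intro Max_ge finite_num_distances assms(3))
      (use Metric_space_transport[OF h assms(1)] k_homogeneous_transport[OF h assms(4)] in force)
qed

lemma num_distances_le_Delta_ultra:
  fixes X :: "'a set"
  assumes "Metric_space X d" "card X = n" "n \<ge> 1" "ultrahomogeneous X d"
  shows "num_distances X d \<le> Delta_ultra n"
proof -
  have "finite X"
    using assms(2,3) by (metis card.infinite not_one_le_zero)
  then obtain h where h: "bij_betw h X {0..<n}"
    using ex_bij_betw_finite_nat assms(2) by blast
  let ?e = "\<lambda>u v. d (the_inv_into X h u) (the_inv_into X h v)"
  have "ultrahomogeneous {0..<n} ?e"
    using assms(4) k_homogeneous_transport[OF h] by (auto simp: ultrahomogeneous_def)
  then show ?thesis
    unfolding Delta_ultra_def num_distances_transport[OF h, of d, symmetric]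
    by (intro Max_ge finite_num_distances assms(3))
      (use Metric_space_transport[OF h assms(1)] in force)
qed

end

theory Submission
  imports Defs "HOL-Algebra.Multiplicative_Group" "HOL-Algebra.Sylow" "HOL-Number_Theory.Cong"
begin

text \<open>
  The theorem rests on an upper bound for 2-homogeneous spaces and on a construction that attains it.

  Upper bound. In a 2-homogeneous space \<open>X\<close> of size \<open>n\<close> every distance already occurs at a
  base point \<open>x\<close>, and the isometries that fix \<open>x\<close> act transitively on each sphere around \<open>x\<close>. So
  \<open>y\<close> is alone on its sphere around \<open>x\<close> iff every isometry fixing \<open>x\<close> fixes \<open>y\<close>. In this form the
  relation is clearly transitive; it is symmetric because some isometry swaps \<open>x\<close> and \<open>y\<close>. Its
  classes are permuted transitively by the isometries, so they have a common size \<open>u\<close>, which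
  divides \<open>n\<close>. An isometry is determined on a class \<open>C\<close> by its value at one point of \<open>C\<close>, so the
  isometries that stabilise \<open>C\<close> induce on it a group of order \<open>u\<close>. An element that maps \<open>x\<close> to \<open>y\<close>
  agrees on \<open>C\<close> with an isometry that swaps \<open>x\<close> and \<open>y\<close>, so its square is the identity. By
  Sylow's theorem no odd prime divides \<open>u\<close>; hence \<open>u\<close> divides \<open>2 ^ m\<close>. The \<open>u\<close> singleton spheres
  give \<open>u\<close> distances and all other spheres have at least two points, so the number \<open>\<delta>\<close> of
  distances satisfies \<open>2 * \<delta> \<le> n + u \<le> 2 ^ m * (2 * k + 1) + 2 ^ m = 2 * (2 ^ m * (k + 1))\<close>
  (\<open>twice_num_distances_le\<close>, \<open>num_distances_bound\<close>).

  Construction. On the abelian group \<open>(\<int>/2)^m \<times> \<int>/(2k+1)\<close> let the distance of two elements depend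
  exactly on their difference up to sign. There are \<open>2 ^ m * (k + 1)\<close> such classes of differences,
  and giving the nonzero ones distinct values in \<open>(1, 2]\<close> makes the triangle inequality automatic. A
  partial isometry preserves differences up to sign; as the second factor has odd order, the sign
  can be chosen uniformly (\<open>partial_isometry_odd_cycle\<close>), so the partial isometry is the
  restriction of a translation or of a translation composed with negation
  (\<open>ex_ultrahomogeneous_many_distances\<close>).

  The bound \<open>\<Delta>\<^sub>1(n) \<le> n\<close> only uses that all distances occur at a single point.
\<close>

section \<open>Extending isometries\<close>

lemma isometry_dist:
  assumes "bijective_isometry d A B g" "x \<in> A" "y \<in> A"
  shows "d (g x) (g y) = d x y"
  using assms by (simp add: bijective_isometry_def)

lemma isometry_in:
  assumes "bijective_isometry d A B g" "x \<in> A"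
  shows "g x \<in> B"
  using assms by (auto simp: bijective_isometry_def bij_betw_def)

lemma bijective_isometry_compose:
  assumes "bijective_isometry d A B f" "bijective_isometry d B C g"
  shows "bijective_isometry d A C (g \<circ> f)"
  using assms bij_betw_trans[of f A B g C] bij_betwE[of f A B]
  by (auto simp: bijective_isometry_def)

lemma bijective_isometry_inv_into:
  assumes "bijective_isometry d A B f"
  shows "bijective_isometry d B A (inv_into A f)"
proof -
  have f: "bij_betw f A B" and iso: "\<And>x y. x \<in> A \<Longrightarrow> y \<in> A \<Longrightarrow> d (f x) (f y) = d x y"
    using assms by (auto simp: bijective_isometry_def)
  have "d (inv_into A f u) (inv_into A f v) = d u v" if "u \<in> B" "v \<in> B" for u v
    using that f iso[of "inv_into A f u" "inv_into A f v"]
    by (simp add: bij_betw_inv_into_right bij_betwE[OF bij_betw_inv_into[OF f]])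
  then show ?thesis
    using f by (simp add: bijective_isometry_def bij_betw_inv_into)
qed

lemma homogeneous_point_transitive:
  assumes "k_homogeneous k X d" "1 \<le> k" "\<And>z. z \<in> X \<Longrightarrow> d z z = 0" "x \<in> X" "y \<in> X"
  obtains g where "bijective_isometry d X X g" "g x = y"
proof -
  have "bijective_isometry d {x} {y} (\<lambda>_. y)"
    using assms by (simp add: bijective_isometry_def bij_betw_def)
  moreover have "{x} \<subseteq> X" "{y} \<subseteq> X" "finite {x}" "card {x} \<le> k"
    using assms(2,4,5) by auto
  ultimately have "\<exists>g. bijective_isometry d X X g \<and> (\<forall>z\<in>{x}. g z = y)"
    using assms(1) unfolding k_homogeneous_def by blast
  then show ?thesis
    using that by blast
qed

text \<open>
  Used with \<open>(x', y') = (y, x)\<close>, which provides an isometry that swaps two given points, and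
  with \<open>x' = x\<close>, which makes the stabiliser of \<open>x\<close> transitive on the spheres around \<open>x\<close>.
\<close>
lemma homogeneous_pair_transitive:
  assumes "Metric_space X d" "k_homogeneous k X d" "2 \<le> k"
    and "x \<in> X" "y \<in> X" "x' \<in> X" "y' \<in> X" "d x y = d x' y'"
  obtains g where "bijective_isometry d X X g" "g x = x'" "g y = y'"
proof -
  interpret Metric_space X d by fact
  let ?f = "\<lambda>z. if z = x then x' else y'"
  have eq: "x = y \<longleftrightarrow> x' = y'"
    using assms zero by metis
  have "bijective_isometry d {x, y} {x', y'} ?f"
    using assms eq by (auto simp: bijective_isometry_def bij_betw_def inj_on_def commute)
  moreover have "card {x, y} \<le> k"
    using assms(3) by (cases "x = y") auto
  moreover have "{x, y} \<subseteq> X" "{x', y'} \<subseteq> X" "finite {x, y}"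
    using assms(4-7) by auto
  ultimately have "\<exists>g. bijective_isometry d X X g \<and> (\<forall>z\<in>{x, y}. g z = ?f z)"
    using assms(2) unfolding k_homogeneous_def by blast
  then obtain g where "bijective_isometry d X X g" "\<forall>z\<in>{x, y}. g z = ?f z"
    by blast
  then show ?thesis
    using that eq by (cases "x = y") auto
qed

lemma num_distances_from_point:
  assumes "Metric_space X d" "k_homogeneous k X d" "1 \<le> k" "x \<in> X"
  shows "num_distances X d = card (d x ` X)"
proof -
  interpret Metric_space X d by fact
  have "d y z \<in> d x ` X" if yz: "y \<in> X" "z \<in> X" for y z
  proof -
    obtain g where g: "bijective_isometry d X X g" "g y = x"
      using homogeneous_point_transitive[OF assms(2,3) _ yz(1) assms(4)] by auto
    then have "d y z = d x (g z)" "g z \<in> X"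
      using yz isometry_dist[OF g(1), of y z] isometry_in[OF g(1), of z] by auto
    then show ?thesis by blast
  qed
  then have "{d y z | y z. y \<in> X \<and> z \<in> X} = d x ` X"
    using assms(4) by blast
  then show ?thesis
    by (simp add: num_distances_def)
qed

section \<open>Two counting lemmas\<close>

text \<open>
  \<open>S\<close> is a group of exponent two. For a prime divisor \<open>p\<close> of its order take a subgroup \<open>H\<close> of order
  \<open>p\<close>. If \<open>p\<close> were odd, each \<open>f\<close> in \<open>H\<close> would satisfy both \<open>f\<^sup>2 = 1\<close> and \<open>f\<^sup>p = 1\<close>, and \<open>H\<close> would
  be trivial.
\<close>
lemma odd_prime_not_dvd_card_involutions:
  fixes S :: "('a \<Rightarrow> 'a) set"
  assumes "finite S" "id \<in> S" and comp: "\<And>f g. f \<in> S \<Longrightarrow> g \<in> S \<Longrightarrow> f \<circ> g \<in> S"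
    and invol: "\<And>f. f \<in> S \<Longrightarrow> f \<circ> f = id"
    and p: "prime p" "p dvd card S"
  shows "p = 2"
proof (rule ccontr)
  assume "p \<noteq> 2"
  define G :: "('a \<Rightarrow> 'a) monoid" where "G = \<lparr>carrier = S, monoid.mult = (\<circ>), one = id\<rparr>"
  have G: "group G"
    unfolding G_def using assms(2) comp invol by (intro groupI) (auto simp: o_assoc)
  obtain q where "order G = p ^ 1 * q"
    using p(2) by (auto simp: order_def G_def)
  from sylow_thm[OF p(1) G this] obtain H where H: "subgroup H G" "card H = p"
    using assms(1) by (auto simp: G_def)
  have "f = id" if "f \<in> H" for f
  proof -
    interpret H: group "G\<lparr>carrier := H\<rparr>"
      using H(1) G by (rule subgroup.subgroup_is_group)
    have fH: "f \<in> carrier (G\<lparr>carrier := H\<rparr>)" and fS: "f \<in> S"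
      using that subgroup.subset[OF H(1)] by (auto simp: G_def)
    have 2: "f [^]\<^bsub>G\<lparr>carrier := H\<rparr>\<^esub> (2::nat) = id"
      using invol[OF fS] by (simp add: numeral_2_eq_2 G_def)
    have "f [^]\<^bsub>G\<lparr>carrier := H\<rparr>\<^esub> p = id"
      using H.pow_order_eq_1[OF fH] H(2) by (simp add: order_def G_def)
    moreover have "odd p"
      using p(1) \<open>p \<noteq> 2\<close> primes_dvd_imp_eq two_is_prime_nat by blast
    then obtain l where "p = 2 * l + 1"
      by (elim oddE)
    ultimately show "f = id"
      using H.nat_pow_mult[OF fH, of "2 * l" 1] H.nat_pow_pow[OF fH, of 2 l] 2
      using H.nat_pow_one[of l] fH
      by (simp add: G_def)
  qed
  then have "card H \<le> card {id :: 'a \<Rightarrow> 'a}"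
    by (intro card_mono) auto
  then show False
    using H(2) prime_gt_1_nat[OF p(1)] by simp
qed

lemma twice_card_image_le:
  assumes "finite A" "\<And>a. a \<in> A \<Longrightarrow> \<exists>b\<in>A. b \<noteq> a \<and> f b = f a"
  shows "2 * card (f ` A) \<le> card A"
proof -
  have "(\<Sum>y\<in>f ` A. 2) \<le> (\<Sum>y\<in>f ` A. card {x \<in> A. f x = y})"
  proof (rule sum_mono)
    fix y assume "y \<in> f ` A"
    then obtain a where a: "a \<in> A" "f a = y"
      by blast
    then obtain b where b: "b \<in> A" "b \<noteq> a" "f b = y"
      using assms(2) by blast
    have "card {a, b} \<le> card {x \<in> A. f x = y}"
      by (rule card_mono) (use assms(1) a b in auto)
    then show "2 \<le> card {x \<in> A. f x = y}"
      using b(2) by simp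
  qed
  also have "\<dots> = card A"
    using sum.image_gen[OF assms(1), of "\<lambda>_. 1::nat" f] by simp
  finally show ?thesis by simp
qed

section \<open>Points determined by their distance to a given point\<close>

text \<open>
  \<open>sole X d x y\<close>: the sphere around \<open>x\<close> through \<open>y\<close> is the singleton \<open>{y}\<close>.
\<close>
definition sole :: "'a set \<Rightarrow> ('a \<Rightarrow> 'a \<Rightarrow> real) \<Rightarrow> 'a \<Rightarrow> 'a \<Rightarrow> bool" where
  "sole X d x y \<longleftrightarrow> x \<in> X \<and> y \<in> X \<and> (\<forall>z\<in>X. d x z = d x y \<longrightarrow> z = y)"

lemma sole_isometry:
  assumes "bijective_isometry d X X g" "sole X d x y"
  shows "sole X d (g x) (g y)"
proof -
  have g: "g ` X = X" and iso: "\<And>u v. u \<in> X \<Longrightarrow> v \<in> X \<Longrightarrow> d (g u) (g v) = d u v"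
    using assms(1) by (auto simp: bijective_isometry_def bij_betw_def)
  have "z = g y" if "z \<in> X" "d (g x) z = d (g x) (g y)" for z
  proof -
    obtain w where "w \<in> X" "z = g w"
      using \<open>z \<in> X\<close> g by blast
    then show ?thesis
      using that iso assms(2) by (auto simp: sole_def)
  qed
  then show ?thesis
    using assms(2) g by (auto simp: sole_def)
qed

locale two_homogeneous_space = Metric_space X d for X :: "'a set" and d +
  assumes finite: "finite X" and homogeneous: "k_homogeneous 2 X d"
begin

abbreviation isometry :: "('a \<Rightarrow> 'a) \<Rightarrow> bool" where
  "isometry \<equiv> bijective_isometry d X X"

lemma pair_transitive:
  assumes "x \<in> X" "y \<in> X" "x' \<in> X" "y' \<in> X" "d x y = d x' y'"
  obtains g where "isometry g" "g x = x'" "g y = y'"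
  using homogeneous_pair_transitive[OF Metric_space_axioms homogeneous _ assms] by auto

lemma point_transitive:
  assumes "x \<in> X" "y \<in> X"
  obtains g where "isometry g" "g x = y"
  using homogeneous_point_transitive[OF homogeneous _ _ assms] by auto

text \<open>
  An isometry fixing \<open>x\<close> preserves the spheres around \<open>x\<close>, hence fixes a sphere that is a single
  point; conversely, 2-homogeneity lets the stabiliser of \<open>x\<close> move \<open>y\<close> to any other point of its
  sphere. The right-hand side makes transitivity of \<open>sole\<close> evident.
\<close>
lemma sole_iff_fixed:
  assumes "x \<in> X" "y \<in> X"
  shows "sole X d x y \<longleftrightarrow> (\<forall>g. isometry g \<longrightarrow> g x = x \<longrightarrow> g y = y)"
proof
  assume sole: "sole X d x y"
  show "\<forall>g. isometry g \<longrightarrow> g x = x \<longrightarrow> g y = y"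
  proof (intro allI impI)
    fix g assume g: "isometry g" "g x = x"
    then have "d x (g y) = d x y" "g y \<in> X"
      using assms isometry_dist[OF g(1), of x y] isometry_in by auto
    then show "g y = y"
      using sole by (simp add: sole_def)
  qed
next
  assume R: "\<forall>g. isometry g \<longrightarrow> g x = x \<longrightarrow> g y = y"
  have "z = y" if z: "z \<in> X" "d x z = d x y" for z
  proof -
    obtain g where "isometry g" "g x = x" "g y = z"
      by (rule pair_transitive[OF assms assms(1) z(1) z(2)[symmetric]])
    then show ?thesis
      using R by force
  qed
  then show "sole X d x y"
    using assms by (auto simp: sole_def)
qed

lemma sole_refl: "x \<in> X \<Longrightarrow> sole X d x x"
  by (simp add: sole_iff_fixed)

lemma sole_sym:
  assumes "sole X d x y"
  shows "sole X d y x"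
proof -
  have xy: "x \<in> X" "y \<in> X"
    using assms by (auto simp: sole_def)
  obtain g where "isometry g" "g x = y" "g y = x"
    by (rule pair_transitive[OF xy xy(2,1) commute])
  then show ?thesis
    using sole_isometry[of d X g x y] assms by simp
qed

lemma sole_trans:
  assumes "sole X d x y" "sole X d y z"
  shows "sole X d x z"
proof -
  have "x \<in> X" "y \<in> X" "z \<in> X"
    using assms by (auto simp: sole_def)
  then show ?thesis
    using assms by (simp add: sole_iff_fixed)
qed

definition sole_class :: "'a \<Rightarrow> 'a set" where
  "sole_class x = {y. sole X d x y}"

lemma sole_class_subset: "sole_class x \<subseteq> X"
  by (auto simp: sole_class_def sole_def)

lemma finite_sole_class: "finite (sole_class x)"
  using sole_class_subset finite by (rule finite_subset)

lemma card_sole_class_le: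
  assumes "x \<in> X" "y \<in> X"
  shows "card (sole_class x) \<le> card (sole_class y)"
proof -
  obtain g where g: "isometry g" "g x = y"
    by (rule point_transitive[OF assms])
  have "inj_on g (sole_class x)"
    using g(1) sole_class_subset unfolding bijective_isometry_def bij_betw_def
    by (meson inj_on_subset)
  moreover have "g ` sole_class x \<subseteq> sole_class y"
    using sole_isometry[OF g(1), of x] g(2) by (auto simp: sole_class_def)
  ultimately show ?thesis
    using card_inj_on_le finite_sole_class by blast
qed

lemma card_sole_class_dvd:
  assumes "x \<in> X"
  shows "card (sole_class x) dvd card X"
proof (rule equiv_imp_dvd_card[OF finite])
  let ?R = "{(x, y). sole X d x y}"
  show "equiv X ?R"
  proof (rule equivI)
    show "?R \<subseteq> X \<times> X"
      by (auto simp: sole_def)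
    show "refl_on X ?R"
      by (simp add: refl_on_def sole_refl)
    show "sym ?R"
      using sole_sym by (auto intro: symI)
    show "trans ?R"
      using sole_trans by (auto intro: transI)
  qed
  fix C assume "C \<in> X // ?R"
  then obtain y where y: "y \<in> X" "C = sole_class y"
    by (auto simp: quotient_def sole_class_def)
  then have "card C = card (sole_class x)"
    using card_sole_class_le[OF assms y(1)] card_sole_class_le[OF y(1) assms] by simp
  then show "card (sole_class x) dvd card C" by simp
qed

text \<open>
  \<open>h\<^sup>-\<^sup>1 \<circ> g\<close> fixes \<open>x\<close>, hence fixes every point of the class of \<open>x\<close>.
\<close>
lemma sole_class_isometries_agree:
  assumes "isometry g" "isometry h" "g x = h x" "y \<in> sole_class x"
  shows "g y = h y"
proof -
  have h: "bij_betw h X X" and xy: "x \<in> X" "y \<in> X" "sole X d x y"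
    using assms by (auto simp: bijective_isometry_def sole_class_def sole_def)
  let ?k = "inv_into X h \<circ> g"
  have "isometry ?k"
    by (rule bijective_isometry_compose[OF assms(1) bijective_isometry_inv_into[OF assms(2)]])
  moreover have "?k x = x"
    using h xy assms(3) by (simp add: bij_betw_inv_into_left)
  ultimately have "?k y = y"
    using sole_iff_fixed xy by blast
  moreover have "g y \<in> X"
    by (rule isometry_in[OF assms(1) xy(2)])
  ultimately show ?thesis
    using h by (metis bij_betw_inv_into_right comp_apply)
qed

text \<open>
  The isometries that stabilise the class of \<open>x\<close> induce on it a group of permutations. Evaluation at
  \<open>x\<close> is a bijection from this group onto the class, and all its elements are involutions, since
  each agrees on the class with an isometry that swaps \<open>x\<close> and its image.
\<close>
lemma odd_prime_not_dvd_card_sole_class: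
  assumes x: "x \<in> X" and p: "prime p" "p dvd card (sole_class x)"
  shows "p = 2"
proof -
  define C where "C = sole_class x"
  \<comment> \<open>Extending the restrictions to \<open>C\<close> by the identity makes them closed under plain composition,
    with \<open>id\<close> as the unit.\<close>
  define r where "r g = (\<lambda>y. if y \<in> C then g y else y)" for g :: "'a \<Rightarrow> 'a"
  define S where "S = r ` {g. isometry g \<and> g x \<in> C}"
  have xC: "x \<in> C" and CX: "C \<subseteq> X"
    using sole_refl x sole_class_subset by (auto simp: C_def sole_class_def)
  have stable: "g y \<in> C" if "isometry g" "g x \<in> C" "y \<in> C" for g y
    using sole_isometry[OF that(1), of x y] sole_trans[of x "g x" "g y"] that(2,3)
    by (simp add: C_def sole_class_def)
  have agree: "r g = r h" if "isometry g" "isometry h" "g x = h x" for g h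
    using sole_class_isometries_agree[OF that] by (auto simp: r_def C_def)
  have ex: "\<exists>g. isometry g \<and> g x = y \<and> g y = x" if "y \<in> C" for y
  proof -
    have y: "y \<in> X"
      using that CX by blast
    show ?thesis
      by (rule pair_transitive[OF x y y x commute]) blast
  qed
  have r_comp: "r g \<circ> r h = r (g \<circ> h)" if "isometry h" "h x \<in> C" for g h
    using stable[OF that] by (auto simp: r_def)
  have "bij_betw (\<lambda>s. s x) S C"
    unfolding bij_betw_def
  proof
    show "inj_on (\<lambda>s. s x) S"
      using xC agree by (auto simp: inj_on_def S_def r_def)
    show "(\<lambda>s. s x) ` S = C"
    proof
      show "(\<lambda>s. s x) ` S \<subseteq> C"
        using xC by (auto simp: S_def r_def)
      show "C \<subseteq> (\<lambda>s. s x) ` S"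
      proof
        fix y assume "y \<in> C"
        with ex obtain g where g: "isometry g" "g x = y"
          by blast
        then have "r g \<in> S" "y = r g x"
          using \<open>y \<in> C\<close> xC by (auto simp: S_def r_def)
        then show "y \<in> (\<lambda>s. s x) ` S" by blast
      qed
    qed
  qed
  then have card: "card S = card C" and fin: "finite S"
    using bij_betw_same_card bij_betw_finite finite_sole_class C_def by blast+
  have id: "isometry id"
    by (simp add: bijective_isometry_def)
  have r_id: "r id = id"
    by (auto simp: r_def)
  have "id \<in> S"
    using id xC r_id by (force simp: S_def)
  moreover have "s \<circ> t \<in> S" if st: "s \<in> S" "t \<in> S" for s t
  proof -
    obtain g h where g: "isometry g" "g x \<in> C" "s = r g" and h: "isometry h" "h x \<in> C" "t = r h"
      using st unfolding S_def by blast
    have "s \<circ> t = r (g \<circ> h)"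
      using r_comp[OF h(1,2)] g(3) h(3) by simp
    moreover have "isometry (g \<circ> h)" "(g \<circ> h) x \<in> C"
      using bijective_isometry_compose[OF h(1) g(1)] stable[OF g(1,2) h(2)] by simp_all
    ultimately show ?thesis
      unfolding S_def by blast
  qed
  moreover have "s \<circ> s = id" if sS: "s \<in> S" for s
  proof -
    obtain g where g: "isometry g" "g x \<in> C" "s = r g"
      using sS by (auto simp: S_def)
    from ex[OF g(2)] obtain h where h: "isometry h" "h x = g x" "h (g x) = x"
      by blast
    have "s = r h"
      using agree[OF g(1) h(1)] g(3) h(2) by simp
    then have "s \<circ> s = r (h \<circ> h)"
      using r_comp[OF h(1)] h(2) g(2) by simp
    also have "\<dots> = r id"
      using h by (intro agree bijective_isometry_compose[OF h(1) h(1)] id) simp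
    finally show ?thesis
      using r_id by simp
  qed
  ultimately show ?thesis
    using odd_prime_not_dvd_card_involutions[OF fin] p card by (auto simp: C_def)
qed

text \<open>
  The distances from \<open>x\<close> to points of its class number at most the size of the class. The other
  spheres around \<open>x\<close> lie outside the class and have at least two points each.
\<close>
lemma twice_num_distances_le:
  assumes x: "x \<in> X"
  shows "2 * num_distances X d \<le> card X + card (sole_class x)"
proof -
  let ?C = "sole_class x"
  have "num_distances X d = card (d x ` X)"
    using num_distances_from_point[OF Metric_space_axioms homogeneous _ x] by simp
  also have "d x ` X = d x ` ?C \<union> d x ` (X - ?C)"
    using sole_class_subset by blast
  also have "card \<dots> \<le> card (d x ` ?C) + card (d x ` (X - ?C))"
    by (rule card_Un_le)
  also have "card (d x ` ?C) \<le> card ?C"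
    using finite_sole_class by (rule card_image_le)
  finally have 1: "num_distances X d \<le> card ?C + card (d x ` (X - ?C))"
    by simp
  have "2 * card (d x ` (X - ?C)) \<le> card (X - ?C)"
  proof (rule twice_card_image_le)
    fix y assume y: "y \<in> X - ?C"
    then obtain z where "z \<in> X" "d x z = d x y" "z \<noteq> y"
      using x by (auto simp: sole_class_def sole_def)
    moreover from this have "z \<notin> ?C"
      using y by (auto simp: sole_class_def sole_def)
    ultimately show "\<exists>z\<in>X - ?C. z \<noteq> y \<and> d x z = d x y" by blast
  qed (use finite in simp)
  moreover have "card (X - ?C) = card X - card ?C" "card ?C \<le> card X"
    using sole_class_subset finite finite_sole_class by (auto simp: card_Diff_subset card_mono)
  ultimately show ?thesis
    using 1 by linarith
qed

lemma num_distances_bound: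
  assumes "card X = 2 ^ m * (2 * k + 1)"
  shows "num_distances X d \<le> 2 ^ m * (k + 1)"
proof -
  have "X \<noteq> {}"
    using assms by auto
  then obtain x where x: "x \<in> X" by blast
  let ?u = "card (sole_class x)"
  have "coprime ?u (2 * k + 1)"
  proof (rule ccontr)
    assume "\<not> coprime ?u (2 * k + 1)"
    then have "gcd ?u (2 * k + 1) \<noteq> 1"
      by (simp add: coprime_iff_gcd_eq_1)
    then obtain p where "prime p" "p dvd gcd ?u (2 * k + 1)"
      using prime_factor_nat by blast
    then have p: "prime p" "p dvd ?u" "p dvd 2 * k + 1"
      by simp_all
    then have "p = 2"
      using odd_prime_not_dvd_card_sole_class[OF x] by blast
    with p(3) show False by simp
  qed
  then have "?u dvd 2 ^ m"
    using card_sole_class_dvd[OF x] unfolding assms by (simp only: coprime_dvd_mult_left_iff)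
  then have "?u \<le> 2 ^ m"
    by (rule dvd_imp_le) simp
  then show ?thesis
    using twice_num_distances_le[OF x] assms by (simp add: algebra_simps)
qed

end

section \<open>A space with many distances\<close>

text \<open>
  A symmetric colouring of pairs that separates the diagonal from the rest is realised by a metric:
  the diagonal colour becomes 0 and the other colours become distinct reals in \<open>(1, 2]\<close>, so that
  every sum of two nonzero distances exceeds every distance.
\<close>
lemma metric_of_colouring:
  fixes c :: "'a \<Rightarrow> 'a \<Rightarrow> 'c"
  assumes "finite X"
    and sym: "\<And>x y. c x y = c y x"
    and diag: "\<And>x y u. x \<in> X \<Longrightarrow> y \<in> X \<Longrightarrow> u \<in> X \<Longrightarrow> c x y = c u u \<longleftrightarrow> x = y"
  obtains e where "inj_on e {c x y | x y. x \<in> X \<and> y \<in> X}"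
    and "Metric_space X (\<lambda>x y. e (c x y) :: real)"
proof -
  have "{c x y | x y. x \<in> X \<and> y \<in> X} = (\<lambda>(x, y). c x y) ` (X \<times> X)"
    by auto
  then have "finite {c x y | x y. x \<in> X \<and> y \<in> X}"
    using assms(1) by simp
  then obtain h :: "'c \<Rightarrow> nat" where h: "inj_on h {c x y | x y. x \<in> X \<and> y \<in> X}"
    using finite_imp_inj_to_nat_seg by meson
  define e where "e a = (if \<exists>u\<in>X. a = c u u then 0 else 1 + 1 / (1 + real (h a)))" for a
  have e0: "e a = 0 \<longleftrightarrow> (\<exists>u\<in>X. a = c u u)" for a
    using add_pos_nonneg[of 1 "1 / (1 + real (h a))"] by (auto simp: e_def)
  have e1: "1 < e a" if "\<not> (\<exists>u\<in>X. a = c u u)" for a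
    using that by (simp add: e_def)
  have e2: "e a \<le> 2" for a
    by (auto simp: e_def field_simps)
  have pos: "0 \<le> e a" for a
    using e0[of a] e1[of a] by fastforce
  have "inj_on e {c x y | x y. x \<in> X \<and> y \<in> X}"
  proof (rule inj_onI)
    fix a b assume ab: "a \<in> {c x y | x y. x \<in> X \<and> y \<in> X}" "b \<in> {c x y | x y. x \<in> X \<and> y \<in> X}"
      and eq: "e a = e b"
    show "a = b"
    proof (cases "e a = 0")
      case True
      then obtain u v where "u \<in> X" "v \<in> X" "a = c u u" "b = c v v"
        using e0 eq by metis
      then show ?thesis
        using diag[of u u v] by simp
    next
      case False
      then have "h a = h b"
        using eq e0[of a] e0[of b] by (simp add: e_def)
      then show ?thesis
        by (rule inj_onD[OF h _ ab])
    qed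
  qed
  moreover have "Metric_space X (\<lambda>x y. e (c x y))"
  proof
    fix x y z
    show "0 \<le> e (c x y)" "e (c x y) = e (c y x)"
      using pos sym[of x y] by simp_all
    assume x: "x \<in> X" and y: "y \<in> X"
    show "e (c x y) = 0 \<longleftrightarrow> x = y"
      using e0 diag x y by metis
    assume z: "z \<in> X"
    show "e (c x z) \<le> e (c x y) + e (c y z)"
    proof (cases "x = y \<or> y = z")
      case True
      then show ?thesis using pos by auto
    next
      case False
      then have "1 < e (c x y)" "1 < e (c y z)"
        using e1 diag x y z by metis+
      then show ?thesis
        using e2[of "c x z"] by linarith
    qed
  qed
  ultimately show ?thesis
    by (rule that)
qed

text \<open>
  If differences modulo an odd number are preserved up to sign, one sign serves for all points.
  Otherwise some \<open>p\<close> reflects about \<open>a\<close> without being translated along with \<open>a\<close>, and for some \<open>q\<close>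
  it is the other way round. Comparing \<open>p\<close> with \<open>q\<close> then gives \<open>2 * (u p - u a) = 0\<close> or
  \<open>2 * (u q - u a) = 0\<close> modulo \<open>N\<close>. As 2 is invertible, \<open>p\<close> or \<open>q\<close> coincides with \<open>a\<close> modulo \<open>N\<close>,
  where both signs are correct.
\<close>
lemma partial_isometry_odd_cycle:
  fixes N :: int and u v :: "'a \<Rightarrow> int"
  assumes "odd N" "a \<in> A"
    and pm: "\<And>p q. p \<in> A \<Longrightarrow> q \<in> A \<Longrightarrow>
       [v p - v q = u p - u q] (mod N) \<or> [v p - v q = u q - u p] (mod N)"
  obtains s where "s = 1 \<or> s = -1" "\<And>p. p \<in> A \<Longrightarrow> [v p = v a + s * (u p - u a)] (mod N)"
proof -
  have half: "N dvd t" if "N dvd 2 * t" for t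
    using that assms(1) by (simp add: coprime_dvd_mult_right_iff)
  have "(\<forall>p\<in>A. [v p = v a + (u p - u a)] (mod N)) \<or> (\<forall>p\<in>A. [v p = v a + (u a - u p)] (mod N))"
  proof (rule ccontr)
    assume "\<not> ?thesis"
    then obtain p q where pq: "p \<in> A" "q \<in> A"
      and p: "\<not> N dvd v p - (v a + (u p - u a))" and q: "\<not> N dvd v q - (v a + (u a - u q))"
      by (auto simp: cong_iff_dvd_diff)
    have p': "N dvd v p - v a - (u a - u p)"
      using pm[OF pq(1) assms(2)] p by (auto simp: cong_iff_dvd_diff algebra_simps)
    have q': "N dvd v q - v a - (u q - u a)"
      using pm[OF pq(2) assms(2)] q by (auto simp: cong_iff_dvd_diff algebra_simps)
    from pm[OF pq] consider "N dvd v p - v q - (u p - u q)" | "N dvd v p - v q - (u q - u p)"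
      by (auto simp: cong_iff_dvd_diff)
    then show False
    proof cases
      case 1
      have "2 * (u p - u a) = (v p - v a - (u a - u p)) - (v q - v a - (u q - u a))
          - (v p - v q - (u p - u q))"
        by simp
      also have "N dvd \<dots>"
        by (rule dvd_diff[OF dvd_diff[OF p' q'] 1])
      finally have h: "N dvd u p - u a"
        by (rule half)
      have "N dvd (v p - v a - (u a - u p)) - 2 * (u p - u a)"
        by (rule dvd_diff[OF p' dvd_mult[OF h]])
      then show False
        using p by (simp add: algebra_simps)
    next
      case 2
      have "2 * (u q - u a) = (v p - v a - (u a - u p)) - (v q - v a - (u q - u a))
          - (v p - v q - (u q - u p))"
        by simp
      also have "N dvd \<dots>"
        by (rule dvd_diff[OF dvd_diff[OF p' q'] 2])
      finally have h: "N dvd u q - u a"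
        by (rule half)
      have "N dvd (v q - v a - (u q - u a)) + 2 * (u q - u a)"
        by (rule dvd_add[OF q' dvd_mult[OF h]])
      then show False
        using q by (simp add: algebra_simps)
    qed
  qed
  then show ?thesis
    using that[of 1] that[of "-1"] by (auto simp: algebra_simps)
qed

text \<open>
  The length of the shorter arc between \<open>x\<close> and \<open>y\<close> on a cycle of length \<open>N\<close>: a canonical
  representative of \<open>x - y\<close> modulo \<open>N\<close> up to sign.
\<close>
definition cyclic_dist :: "int \<Rightarrow> int \<Rightarrow> int \<Rightarrow> int" where
  "cyclic_dist N x y = min ((x - y) mod N) ((y - x) mod N)"

lemma cyclic_dist_eq_iff:
  assumes "N > 0"
  shows "cyclic_dist N x y = cyclic_dist N x' y' \<longleftrightarrow>
    [x' - y' = x - y] (mod N) \<or> [x' - y' = y - x] (mod N)"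
proof -
  have neg: "(b - a) mod N = (if (a - b) mod N = 0 then 0 else N - (a - b) mod N)" for a b
    using zmod_zminus1_eq_if[of "a - b" N] by simp
  have bnd: "0 \<le> (a - b) mod N" "(a - b) mod N < N" for a b
    using assms by auto
  show ?thesis
    unfolding cyclic_dist_def cong_def neg[of y x] neg[of y' x']
    using bnd[of x y] bnd[of x' y'] by (auto simp: min_def)
qed


lemma cyclic_dist_commute: "cyclic_dist N x y = cyclic_dist N y x"
  by (simp add: cyclic_dist_def min.commute)

lemma image_cyclic_dist:
  assumes "N = 2 * int k + 1"
  shows "{cyclic_dist N x y | x y. x \<in> {0..<N} \<and> y \<in> {0..<N}} = {0..int k}"
proof (intro equalityI subsetI)
  fix r assume "r \<in> {cyclic_dist N x y | x y. x \<in> {0..<N} \<and> y \<in> {0..<N}}"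
  then obtain x y where r: "r = cyclic_dist N x y" by blast
  have bound: "min a b \<in> {0..int k}" if "b = (if a = 0 then 0 else N - a)" "0 \<le> a" "a < N" for a b
    using that assms by (auto simp: min_def)
  have "(y - x) mod N = (if (x - y) mod N = 0 then 0 else N - (x - y) mod N)"
    using zmod_zminus1_eq_if[of "x - y" N] by simp
  moreover have "0 \<le> (x - y) mod N" "(x - y) mod N < N"
    using assms pos_mod_bound[of N "x - y"] by auto
  ultimately show "r \<in> {0..int k}"
    unfolding r cyclic_dist_def by (rule bound)
next
  fix r assume r: "r \<in> {0..int k}"
  have "(- r) mod N = (if r mod N = 0 then 0 else N - r mod N)"
    by (rule zmod_zminus1_eq_if)
  then have "cyclic_dist N r 0 = r"
    using r assms by (auto simp: cyclic_dist_def min_def)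
  then show "r \<in> {cyclic_dist N x y | x y. x \<in> {0..<N} \<and> y \<in> {0..<N}}"
    using r assms by force
qed

text \<open>
  The space is \<open>(\<int>/2)^m \<times> \<int>/(2k+1)\<close>; the first factor is the power set of \<open>{..<m}\<close> with symmetric
  difference as addition, so that negation changes the second coordinate only.
\<close>
lemma ex_ultrahomogeneous_many_distances:
  "\<exists>(X :: (nat set \<times> int) set) d. Metric_space X d \<and> ultrahomogeneous X d \<and>
     card X = 2 ^ m * (2 * k + 1) \<and> num_distances X d = 2 ^ m * (k + 1)"
proof -
  define N where "N = 2 * int k + 1"
  define X where "X = Pow {..<m} \<times> {0..<N}"
  define c where "c p q = (sym_diff (fst p) (fst q), cyclic_dist N (snd p) (snd q))"
    for p q :: "nat set \<times> int"
  have N: "N > 0" "odd N"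
    by (auto simp: N_def)
  have fin: "finite X"
    by (simp add: X_def)
  have reduced: "x = y" if "[x = y] (mod N)" "x \<in> {0..<N}" "y \<in> {0..<N}" for x y
    using that cong_less_imp_eq_int by auto
  have c_commute: "c p q = c q p" for p q
    by (auto simp: c_def cyclic_dist_commute)
  have c_diag: "c p q = c u u \<longleftrightarrow> p = q" if "p \<in> X" "q \<in> X" "u \<in> X" for p q u
  proof
    assume "c p q = c u u"
    then have "fst p = fst q" "[snd p = snd q] (mod N)"
      using cyclic_dist_eq_iff[OF N(1), of "snd p" "snd q" "snd u" "snd u"]
      by (auto simp: c_def cong_iff_dvd_diff dvd_diff_commute)
    then show "p = q"
      using that reduced by (auto simp: X_def prod_eq_iff)
  qed (simp add: c_def cyclic_dist_def)
  obtain e where e: "inj_on e {c p q | p q. p \<in> X \<and> q \<in> X}"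
    and metric: "Metric_space X (\<lambda>p q. e (c p q) :: real)"
    using metric_of_colouring[OF fin c_commute c_diag] .
  define d where "d = (\<lambda>p q. e (c p q))"
  interpret Metric_space X d
    using metric by (simp add: d_def)
  have d_eq: "d p q = d p' q' \<longleftrightarrow> c p q = c p' q'"
    if "p \<in> X" "q \<in> X" "p' \<in> X" "q' \<in> X" for p q p' q'
  proof -
    have "c p q \<in> {c p q | p q. p \<in> X \<and> q \<in> X}" "c p' q' \<in> {c p q | p q. p \<in> X \<and> q \<in> X}"
      using that by blast+
    then show ?thesis
      unfolding d_def by (rule inj_on_eq_iff[OF e])
  qed
  have "card X = 2 ^ m * (2 * k + 1)"
    by (simp add: X_def N_def card_cartesian_product card_Pow nat_add_distrib nat_mult_distrib)
  moreover have "num_distances X d = 2 ^ m * (k + 1)"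
  proof -
    have "{d p q | p q. p \<in> X \<and> q \<in> X} = e ` {c p q | p q. p \<in> X \<and> q \<in> X}"
      unfolding d_def by blast
    then have "num_distances X d = card {c p q | p q. p \<in> X \<and> q \<in> X}"
      using card_image[OF e] by (simp add: num_distances_def)
    also have "{c p q | p q. p \<in> X \<and> q \<in> X} = Pow {..<m} \<times>
        {cyclic_dist N x y | x y. x \<in> {0..<N} \<and> y \<in> {0..<N}}" (is "?L = ?R")
    proof
      show "?L \<subseteq> ?R"
        by (auto simp: c_def X_def)
      show "?R \<subseteq> ?L"
      proof
        fix r assume "r \<in> ?R"
        then obtain S x y where "r = (S, cyclic_dist N x y)" "S \<subseteq> {..<m}" "x \<in> {0..<N}" "y \<in> {0..<N}"
          by auto
        then have "r = c (S, x) ({}, y)" "(S, x) \<in> X" "({}, y) \<in> X"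
          by (auto simp: c_def X_def)
        then show "r \<in> ?L" by blast
      qed
    qed
    also have "\<dots> = Pow {..<m} \<times> {0..int k}"
      by (simp only: image_cyclic_dist[OF N_def])
    finally show ?thesis
      by (simp add: card_cartesian_product card_Pow nat_add_distrib)
  qed
  moreover have "ultrahomogeneous X d"
    unfolding ultrahomogeneous_def k_homogeneous_def
  proof (intro allI impI)
    fix l :: nat and A B f
    assume H: "A \<subseteq> X \<and> B \<subseteq> X \<and> finite A \<and> card A \<le> l \<and> bijective_isometry d A B f"
    show "\<exists>g. bijective_isometry d X X g \<and> (\<forall>x\<in>A. g x = f x)"
    proof (cases "A = {}")
      case True
      then show ?thesis
        by (intro exI[of _ id]) (simp add: bijective_isometry_def)
    next
      case False
      then obtain a where a: "a \<in> A" by blast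
      have fX: "f p \<in> X" and pX: "p \<in> X" if "p \<in> A" for p
        using H isometry_in[of d A B f p] that by auto
      have fc: "c (f p) (f q) = c p q" if "p \<in> A" "q \<in> A" for p q
        using H that fX pX d_eq by (simp add: bijective_isometry_def)
      have "[snd (f p) - snd (f q) = snd p - snd q] (mod N) \<or>
          [snd (f p) - snd (f q) = snd q - snd p] (mod N)" if "p \<in> A" "q \<in> A" for p q
        using fc[OF that] cyclic_dist_eq_iff[OF N(1), of "snd p" "snd q" "snd (f p)" "snd (f q)"]
        by (simp add: c_def)
      then obtain s where s: "s = 1 \<or> s = -1"
        and sp: "\<And>p. p \<in> A \<Longrightarrow> [snd (f p) = snd (f a) + s * (snd p - snd a)] (mod N)"
        using partial_isometry_odd_cycle[OF N(2) a, of "\<lambda>p. snd (f p)" snd] by blast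
      \<comment> \<open>The extension is translation in the first factor, and translation with sign \<open>s\<close> in the
        second, normalised to send \<open>a\<close> to \<open>f a\<close>.\<close>
      define D where "D = sym_diff (fst a) (fst (f a))"
      define g where "g p = (sym_diff (fst p) D, (snd (f a) + s * (snd p - snd a)) mod N)" for p
      have D: "D \<subseteq> {..<m}"
        using pX[OF a] fX[OF a] by (auto simp: D_def X_def)
      have gX: "g p \<in> X" if "p \<in> X" for p
        using that D N(1) by (auto simp: g_def X_def)
      have "c (g p) (g q) = c p q" for p q
      proof -
        have "[snd (g p) - snd (g q) = s * (snd p - snd q)] (mod N)"
          by (simp add: g_def cong_def mod_diff_eq algebra_simps)
        then have "cyclic_dist N (snd p) (snd q) = cyclic_dist N (snd (g p)) (snd (g q))"
          using s unfolding cyclic_dist_eq_iff[OF N(1)] by auto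
        then show ?thesis
          by (auto simp: c_def g_def)
      qed
      then have iso: "d (g p) (g q) = d p q" for p q
        by (simp add: d_def)
      have "inj_on g X"
        using iso zero gX by (metis inj_onI)
      moreover have "g ` X \<subseteq> X"
        using gX by blast
      ultimately have "bij_betw g X X"
        using fin by (simp add: bij_betw_def endo_inj_surj)
      moreover have "g p = f p" if p: "p \<in> A" for p
      proof -
        have "sym_diff (fst (f p)) (fst (f a)) = sym_diff (fst p) (fst a)"
          using fc[OF p a] by (simp add: c_def)
        then have "sym_diff (fst p) D = fst (f p)"
          unfolding D_def by blast
        moreover have "(snd (f a) + s * (snd p - snd a)) mod N = snd (f p)"
          using sp[OF p] fX[OF p] by (auto simp: cong_def X_def)
        ultimately show ?thesis
          by (simp add: g_def)
      qed
      ultimately show ?thesis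
        using iso by (auto simp: bijective_isometry_def)
    qed
  qed
  ultimately show ?thesis
    using Metric_space_axioms by blast
qed

section \<open>The extremal numbers\<close>

theorem corollary6p6:
  fixes n m k :: nat
  assumes "n \<ge> 1" and "n = 2 ^ m * (2 * k + 1)"
  shows "Delta_ultra n = Delta 2 n \<and> Delta 2 n = 2 ^ m * (k + 1) \<and>
         2 ^ m * (k + 1) \<le> Delta 1 n \<and> Delta 1 n \<le> n"
proof -
  obtain Y :: "(nat set \<times> int) set" and d where Y: "Metric_space Y d" "ultrahomogeneous Y d"
    "card Y = n" "num_distances Y d = 2 ^ m * (k + 1)"
    using ex_ultrahomogeneous_many_distances[of m k] assms(2) by blast
  have lower: "2 ^ m * (k + 1) \<le> Delta_ultra n"
    using num_distances_le_Delta_ultra[OF Y(1,3) assms(1) Y(2)] Y(4) by simp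
  have lower_1: "2 ^ m * (k + 1) \<le> Delta 1 n"
    using num_distances_le_Delta[OF Y(1,3) assms(1), of 1] Y(2,4) by (simp add: ultrahomogeneous_def)
  have finite: "finite X" if "card X = n" for X :: "nat set"
    using assms(1) that card.infinite by fastforce
  have ultra_le: "Delta_ultra n \<le> Delta 2 n"
  proof -
    obtain X :: "nat set" and d where "Metric_space X d" "card X = n" "ultrahomogeneous X d"
        "num_distances X d = Delta_ultra n"
      using Delta_ultra_attained[OF assms(1)] by blast
    then show ?thesis
      using num_distances_le_Delta[of X d n 2] assms(1) by (simp add: ultrahomogeneous_def)
  qed
  have upper: "Delta 2 n \<le> 2 ^ m * (k + 1)"
  proof -
    obtain X :: "nat set" and d where X: "Metric_space X d" "card X = n" "k_homogeneous 2 X d"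
        "num_distances X d = Delta 2 n"
      using Delta_attained[OF assms(1), of 2] by auto
    interpret two_homogeneous_space X d
      using X finite by (simp add: two_homogeneous_space_def two_homogeneous_space_axioms_def)
    show ?thesis
      using num_distances_bound X(2,4) assms(2) by metis
  qed
  have upper_1: "Delta 1 n \<le> n"
  proof -
    obtain X :: "nat set" and d where X: "Metric_space X d" "card X = n" "k_homogeneous 1 X d"
        "num_distances X d = Delta 1 n"
      using Delta_attained[OF assms(1), of 1] by auto
    from X(2) assms(1) obtain x where "x \<in> X"
      by fastforce
    then have "num_distances X d = card (d x ` X)"
      using num_distances_from_point[OF X(1,3)] by simp
    then show ?thesis
      using card_image_le[OF finite[OF X(2)], of "d x"] X(2,4) by simp
  qed
  show ?thesis
    using lower lower_1 ultra_le upper upper_1 by linarith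
qed

end
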